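(* For every integer $k\ge 1$, every randomized online algorithm for chasing sets of cardinality at most $k$ has competitive ratio at least $2^{k-1}$ against an adaptive online adversary.
   Context: Chasing small sets: a player moves in a metric space $(M,d)$, starting at $s_0\in M$. At each time $t=1,\dots,T$ a set $S_t\subseteq M$ with $1\le|S_t|\le k$ is revealed online, and the player must move to some $s_t\in S_t$, paying $d(s_{t-1},s_t)$; $T$ and $k$ are not known in advance. A randomized algorithm's cost is its expected cost. In the adaptive online adversary model, the adversary issues each request after observing the algorithm's past (random) decisions, and must itself serve each request immediately upon issuing it (choosing a point of $S_t$ online); the competitive ratio is the ratio between the algorithm's expected cost and the adversary's expected cost. A competitive ratio of at least $\rho$ means that for every $\rho'<\rho$ the algorithm is not $\rho'$-competitive, i.e. there are adaptive online adversaries making the ratio arbitrarily close to at least $\rho$ (with adversary cost unbounded, so additive constants do not help). *)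

theory Defs
  imports "HOL-Probability.Probability"
begin

text \<open>
  An online algorithm is told the instance: a metric space \<open>(M, d)\<close> and a starting point \<open>s\<^sub>0\<close>.
  It is randomized in the sense of being a random deterministic online algorithm: a seed \<open>\<omega>\<close>, drawn
  once from a probability space \<open>P\<close>, selects a map sending the requests
  \<open>[S\<^sub>1, \<dots>, S\<^sub>t]\<close> revealed so far to the position \<open>s\<^sub>t\<close>. Neither \<open>k\<close> nor the number of requests
  is an argument.
\<close>

type_synonym ('a, 'w) online_alg =
  "'a set \<Rightarrow> ('a \<Rightarrow> 'a \<Rightarrow> real) \<Rightarrow> 'a \<Rightarrow> 'w \<Rightarrow> 'a set list \<Rightarrow> 'a"

text \<open>Infinite sets have cardinality 0, so the lower bound also makes requests finite.\<close>

definition request :: "nat \<Rightarrow> 'a set \<Rightarrow> 'a set \<Rightarrow> bool" where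
  "request k M S \<longleftrightarrow> S \<subseteq> M \<and> 1 \<le> card S \<and> card S \<le> k"

text \<open>
  Measurability into \<open>count_space (last Ss)\<close> says both that the position lies in the current
  request and that each choice of a point is an event.
\<close>

definition randomized_online_alg ::
    "nat \<Rightarrow> 'w measure \<Rightarrow> ('a, 'w) online_alg \<Rightarrow> bool" where
  "randomized_online_alg k P A \<longleftrightarrow>
     prob_space P \<and>
     (\<forall>M d s0 Ss. Metric_space M d \<longrightarrow> s0 \<in> M \<longrightarrow> Ss \<noteq> [] \<longrightarrow> (\<forall>S\<in>set Ss. request k M S) \<longrightarrow>
        (\<lambda>\<omega>. A M d s0 \<omega> Ss) \<in> measurable P (count_space (last Ss)))"

text \<open>
  An adaptive online adversary is a pair \<open>(Q, X)\<close>. After the algorithm has made the moves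
  \<open>h = [s\<^sub>1, \<dots>, s\<^sub>t]\<close>, it issues the request \<open>Q h\<close> and immediately serves it by moving to \<open>X h\<close>,
  that is, before it sees \<open>s\<^sub>t\<^sub>+\<^sub>1\<close>. Its own past requests and moves are determined by \<open>h\<close>.
\<close>

definition adaptive_online_adversary ::
    "nat \<Rightarrow> 'a set \<Rightarrow> ('a list \<Rightarrow> 'a set) \<Rightarrow> ('a list \<Rightarrow> 'a) \<Rightarrow> bool" where
  "adaptive_online_adversary k M Q X \<longleftrightarrow> (\<forall>h. request k M (Q h) \<and> X h \<in> Q h)"

text \<open>
  Positions \<open>[s\<^sub>1, \<dots>, s\<^sub>T]\<close> of the deterministic online algorithm \<open>f\<close> against the requests \<open>Q\<close>:
  \<open>s\<^sub>t\<^sub>+\<^sub>1\<close> answers the requests \<open>Q [], Q [s\<^sub>1], \<dots>, Q [s\<^sub>1, \<dots>, s\<^sub>t]\<close>.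
\<close>

primrec alg_moves :: "('a set list \<Rightarrow> 'a) \<Rightarrow> ('a list \<Rightarrow> 'a set) \<Rightarrow> nat \<Rightarrow> 'a list" where
  "alg_moves f Q 0 = []"
| "alg_moves f Q (Suc t) =
     (let h = alg_moves f Q t in h @ [f (map (\<lambda>i. Q (take i h)) [0..<Suc t])])"

definition adv_moves ::
    "('a set list \<Rightarrow> 'a) \<Rightarrow> ('a list \<Rightarrow> 'a set) \<Rightarrow> ('a list \<Rightarrow> 'a) \<Rightarrow> nat \<Rightarrow> 'a list" where
  "adv_moves f Q X T = map (\<lambda>i. X (take i (alg_moves f Q T))) [0..<T]"

primrec path_cost :: "('a \<Rightarrow> 'a \<Rightarrow> real) \<Rightarrow> 'a \<Rightarrow> 'a list \<Rightarrow> real" where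
  "path_cost d s [] = 0"
| "path_cost d s (x # xs) = d s x + path_cost d x xs"

text \<open>
  For a fixed adversary and a fixed \<open>T\<close> only finitely many plays are possible, so the costs below
  are integrable whenever \<open>A\<close> is a randomized online algorithm.
\<close>

definition alg_expected_cost where
  "alg_expected_cost P (A :: ('a, 'w) online_alg) M d s0 Q T =
     (\<integral>\<omega>. path_cost d s0 (alg_moves (A M d s0 \<omega>) Q T) \<partial>P)"

definition adv_expected_cost where
  "adv_expected_cost P (A :: ('a, 'w) online_alg) M d s0 Q X T =
     (\<integral>\<omega>. path_cost d s0 (adv_moves (A M d s0 \<omega>) Q X T) \<partial>P)"

text \<open>The additive constant may depend on the instance, but not on the adversary or on \<open>T\<close>.\<close>

definition competitive :: "nat \<Rightarrow> 'w measure \<Rightarrow> ('a, 'w) online_alg \<Rightarrow> real \<Rightarrow> bool" where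
  "competitive k P A \<rho> \<longleftrightarrow>
     (\<forall>M d s0. Metric_space M d \<longrightarrow> s0 \<in> M \<longrightarrow>
        (\<exists>C. \<forall>Q X T. adaptive_online_adversary k M Q X \<longrightarrow>
           alg_expected_cost P A M d s0 Q T \<le> \<rho> * adv_expected_cost P A M d s0 Q X T + C))"

definition competitive_ratio_at_least ::
    "nat \<Rightarrow> 'w measure \<Rightarrow> ('a, 'w) online_alg \<Rightarrow> real \<Rightarrow> bool" where
  "competitive_ratio_at_least k P A \<rho> \<longleftrightarrow> (\<forall>\<rho>'<\<rho>. \<not> competitive k P A \<rho>')"

end

theory Submission
  imports Defs
begin

text \<open>
  The points are the leaves of a binary tree of depth \<open>k\<close> with an ultrametric whose distances
  grow so fast with the level that changing sides at one level pays for moving \<open>2 ^ (k - 1)\<close> servers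
  at the level below. With the algorithm at the leaf \<open>z\<close>, the adversary requests one
  fixed leaf in each of the \<open>k\<close> subtrees hanging off the path from the root to \<open>z\<close>. There are
  \<open>2 ^ (k - 1)\<close> adversaries, one for each bottom pair of sibling leaves: it waits in the hanging
  subtree that contains its pair, or, when \<open>z\<close> is in the pair, at the sibling of \<open>z\<close>. They issue
  the same requests, and whenever the algorithm moves, they move in total at most
  as far as the algorithm does; the best of them therefore pays at most a fraction
  \<open>1 / 2 ^ (k - 1)\<close> of the cost of the algorithm, up to an additive constant.
\<close>

section \<open>Averaging over memoryless adversaries\<close>

lemma path_cost_snoc:
  "path_cost d s (xs @ [x]) = path_cost d s xs + d (last (s # xs)) x"
  by (induction xs arbitrary: s) auto

lemma length_alg_moves [simp]: "length (alg_moves f Q t) = t"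
  by (induction t) (auto simp: Let_def)

lemma adv_moves_Suc:
  "adv_moves f Q X (Suc t) = adv_moves f Q X t @ [X (alg_moves f Q t)]"
  by (simp add: adv_moves_def Let_def)

lemma alg_moves_in_lists:
  assumes "\<And>h. request k M (Q h)"
    and "\<And>Ss. Ss \<noteq> [] \<Longrightarrow> (\<forall>S\<in>set Ss. request k M S) \<Longrightarrow> f Ss \<in> last Ss"
  shows "alg_moves f Q t \<in> lists M"
proof (induction t)
  case (Suc t)
  let ?Ss = "map (\<lambda>i. Q (take i (alg_moves f Q t))) [0..<Suc t]"
  have "f ?Ss \<in> last ?Ss"
    by (rule assms(2)) (auto simp: assms(1) simp del: upt_Suc)
  also have "last ?Ss = Q (alg_moves f Q t)" by simp
  also have "\<dots> \<subseteq> M" using assms(1) by (auto simp: request_def)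
  finally show ?case using Suc by (simp add: Let_def)
qed simp

lemma alg_moves_Suc_request:
  assumes "\<And>h. request k M (Q h)"
    and "\<And>Ss. Ss \<noteq> [] \<Longrightarrow> (\<forall>S\<in>set Ss. request k M S) \<Longrightarrow> f Ss \<in> last Ss"
  shows "\<exists>s\<in>Q (alg_moves f Q t). alg_moves f Q (Suc t) = alg_moves f Q t @ [s]"
proof -
  let ?Ss = "map (\<lambda>i. Q (take i (alg_moves f Q t))) [0..<Suc t]"
  have "f ?Ss \<in> last ?Ss"
    by (rule assms(2)) (auto simp: assms(1) simp del: upt_Suc)
  also have "last ?Ss = Q (alg_moves f Q t)" by simp
  finally show ?thesis by (auto simp: Let_def)
qed

lemma randomized_online_alg_answer:
  assumes "randomized_online_alg k P A" "Metric_space M d" "s0 \<in> M" "\<omega> \<in> space P"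
    and "Ss \<noteq> []" "\<forall>S\<in>set Ss. request k M S"
  shows "A M d s0 \<omega> Ss \<in> last Ss"
proof -
  have "(\<lambda>\<omega>. A M d s0 \<omega> Ss) \<in> measurable P (count_space (last Ss))"
    using assms unfolding randomized_online_alg_def by blast
  from measurable_space[OF this assms(4)] show ?thesis by simp
qed

text \<open>The last answer depends on the seed both directly and through the earlier moves. For
  each fixed history it is measurable, and since only countably many histories exist, these pieces
  glue together.\<close>

lemma measurable_alg_moves:
  assumes A: "randomized_online_alg k P A" "Metric_space M d" "s0 \<in> M"
    and M: "countable M" and Q: "\<And>h. request k M (Q h)"
  shows "(\<lambda>\<omega>. alg_moves (A M d s0 \<omega>) Q t) \<in> measurable P (count_space (lists M))"
proof (induction t)
  case (Suc t)
  let ?Ss = "\<lambda>h. map (\<lambda>i. Q (take i h)) [0..<Suc t]"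
  have "(\<lambda>\<omega>. h @ [A M d s0 \<omega> (?Ss h)]) \<in> measurable P (count_space (lists M))"
    if h: "h \<in> lists M" for h
  proof -
    have m: "(\<lambda>\<omega>. A M d s0 \<omega> (?Ss h)) \<in> measurable P (count_space (last (?Ss h)))"
      using A Q unfolding randomized_online_alg_def by (auto simp del: upt_Suc)
    have "last (?Ss h) \<subseteq> M"
      using Q by (auto simp: request_def)
    then have "(\<lambda>s. h @ [s]) \<in> measurable (count_space (last (?Ss h))) (count_space (lists M))"
      using h by auto
    from measurable_compose[OF m this] show ?thesis .
  qed
  then have "(\<lambda>\<omega>. alg_moves (A M d s0 \<omega>) Q t @ [A M d s0 \<omega> (?Ss (alg_moves (A M d s0 \<omega>) Q t))])
      \<in> measurable P (count_space (lists M))"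
    by (rule measurable_compose_countable'[where I = "lists M", OF _ Suc]) (use M in auto)
  then show ?case by (simp add: Let_def)
qed simp

text \<open>A finite \<open>M\<close> leaves finitely many histories of length \<open>t\<close>, so
  every \<open>F\<close> is bounded on them. \<open>F\<close> is arbitrary because the adversary's
  cost is also a function of the algorithm's moves.\<close>

lemma integrable_alg_moves:
  fixes F :: "'a list \<Rightarrow> real"
  assumes A: "randomized_online_alg k P A" "Metric_space M d" "s0 \<in> M"
    and M: "finite M" and Q: "\<And>h. request k M (Q h)"
  shows "integrable P (\<lambda>\<omega>. F (alg_moves (A M d s0 \<omega>) Q t))"
proof -
  interpret prob_space P using A(1) by (simp add: randomized_online_alg_def)
  define H where "H = {h. set h \<subseteq> M \<and> length h = t}"
  have "finite H" unfolding H_def using finite_lists_length_eq[OF M] .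
  then obtain C where C: "\<And>h. h \<in> H \<Longrightarrow> \<bar>F h\<bar> \<le> C"
    by (metis finite_imageI imageI Max_ge)
  have "alg_moves (A M d s0 \<omega>) Q t \<in> H" if "\<omega> \<in> space P" for \<omega>
    using alg_moves_in_lists[OF Q randomized_online_alg_answer[OF A that]]
    by (auto simp: H_def in_lists_conv_set)
  with C have b: "AE \<omega> in P. norm (F (alg_moves (A M d s0 \<omega>) Q t)) \<le> C"
    by (intro AE_I2) auto
  have "F \<in> measurable (count_space (lists M)) borel" by simp
  from measurable_compose[OF measurable_alg_moves[OF A countable_finite[OF M] Q] this]
  show ?thesis by (intro integrable_const_bound[OF b])
qed

text \<open>Requests depend only on the algorithm's position, so all members of \<open>E\<close>
  provoke the same play and their costs can be summed. By \<open>moves\<close> the sum stays within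
  a constant of the algorithm's cost, and by \<open>far\<close> that cost is unbounded, which
  defeats any additive constant.\<close>

lemma not_competitive_memoryless:
  fixes A :: "('a, 'w) online_alg" and X :: "'e \<Rightarrow> 'a \<Rightarrow> 'a"
  assumes A: "randomized_online_alg k P A"
    and M: "Metric_space M d" "s0 \<in> M" "finite M"
    and R: "\<And>z. z \<in> M \<Longrightarrow> request k M (R z)"
    and far: "\<And>z z'. z \<in> M \<Longrightarrow> z' \<in> R z \<Longrightarrow> 1 \<le> d z z'"
    and E: "finite E" "E \<noteq> {}"
    and X: "\<And>e z. e \<in> E \<Longrightarrow> z \<in> M \<Longrightarrow> X e z \<in> R z"
    and moves: "\<And>z z'. z \<in> M \<Longrightarrow> z' \<in> R z \<Longrightarrow> (\<Sum>e\<in>E. d (X e z) (X e z')) \<le> d z z'"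
    and "\<rho> < real (card E)"
  shows "\<not> competitive k P A \<rho>"
proof
  assume comp: "competitive k P A \<rho>"
  interpret prob_space P using A by (simp add: randomized_online_alg_def)
  interpret Metric_space M d by fact
  define N where "N = real (card E)"
  have N: "N > 0" using E by (simp add: N_def card_gt_0_iff)
  \<comment> \<open>An adversary must answer every list, including those that are not plays.\<close>
  define cur where "cur h = (if last (s0 # h) \<in> M then last (s0 # h) else s0)" for h
  define Q where "Q h = R (cur h)" for h
  define Y where "Y e h = X e (cur h)" for e h
  have cur: "cur h \<in> M" for h using M(2) by (simp add: cur_def)
  have Q: "request k M (Q h)" for h using R cur by (simp add: Q_def)
  have adv: "adaptive_online_adversary k M Q (Y e)" if "e \<in> E" for e
    using that R X cur by (simp add: adaptive_online_adversary_def Q_def Y_def)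
  define alg where "alg t \<omega> = path_cost d s0 (alg_moves (A M d s0 \<omega>) Q t)" for t \<omega>
  define ad where "ad e t \<omega> = path_cost d s0 (adv_moves (A M d s0 \<omega>) Q (Y e) t)" for e t \<omega>
  \<comment> \<open>Total cost of the adversaries' opening moves, made before the algorithm has
    moved.\<close>
  define K where "K = (\<Sum>e\<in>E. d s0 (X e s0))"

  have int_alg: "integrable P (alg t)" for t
    unfolding alg_def[abs_def] by (rule integrable_alg_moves[OF A M Q])
  have int_ad: "integrable P (ad e t)" for e t
    unfolding ad_def[abs_def] adv_moves_def
    by (rule integrable_alg_moves[OF A M Q, where F = "\<lambda>h. path_cost d s0 (map (\<lambda>i. Y e (take i h)) [0..<t])"])

  \<comment> \<open>The adversaries serve request \<open>t + 1\<close> before the algorithm does, so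
    their first \<open>t + 1\<close> moves are charged to its first \<open>t\<close>.\<close>
  have alg_ge: "real t \<le> alg t \<omega>"
    and ad_le: "(\<Sum>e\<in>E. ad e (Suc t) \<omega>) \<le> K + alg t \<omega>"
    if \<omega>: "\<omega> \<in> space P" for t \<omega>
  proof -
    let ?f = "A M d s0 \<omega>"
    note ans = randomized_online_alg_answer[OF A M(1,2) \<omega>]
    have inM: "last (s0 # alg_moves ?f Q t) \<in> M" for t
    proof -
      have "set (s0 # alg_moves ?f Q t) \<subseteq> M"
        using alg_moves_in_lists[OF Q ans, where t = t] M(2) by (auto simp: in_lists_conv_set)
      then show ?thesis using last_in_set[of "s0 # alg_moves ?f Q t"] by blast
    qed
    have cur_eq: "cur (alg_moves ?f Q t) = last (s0 # alg_moves ?f Q t)" for t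
      using inM by (simp only: cur_def if_True)
    have step: "\<exists>s. alg_moves ?f Q (Suc t) = alg_moves ?f Q t @ [s] \<and> s \<in> R (cur (alg_moves ?f Q t))
        \<and> cur (alg_moves ?f Q (Suc t)) = s \<and> alg (Suc t) \<omega> = alg t \<omega> + d (cur (alg_moves ?f Q t)) s" for t
    proof -
      obtain s where s: "alg_moves ?f Q (Suc t) = alg_moves ?f Q t @ [s]" "s \<in> Q (alg_moves ?f Q t)"
        using alg_moves_Suc_request[where Q = Q and f = ?f and t = t, OF Q ans] by blast
      moreover have "cur (alg_moves ?f Q (Suc t)) = s"
        using cur_eq[of "Suc t"] unfolding s(1) by simp
      moreover have "alg (Suc t) \<omega> = alg t \<omega> + d (cur (alg_moves ?f Q t)) s"
        unfolding alg_def s(1) path_cost_snoc cur_eq ..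
      ultimately show ?thesis by (auto simp: Q_def)
    qed
    show "real t \<le> alg t \<omega>"
    proof (induction t)
      case (Suc t)
      from step[of t] far[OF cur] Suc show ?case by force
    qed (simp add: alg_def)
    have last_adv: "last (s0 # adv_moves ?f Q (Y e) (Suc t)) = X e (cur (alg_moves ?f Q t))" for e t
      by (simp add: adv_moves_Suc Y_def)
    show "(\<Sum>e\<in>E. ad e (Suc t) \<omega>) \<le> K + alg t \<omega>"
    proof (induction t)
      case 0
      then show ?case using M(2)
        by (simp add: ad_def alg_def adv_moves_def Y_def cur_def K_def)
    next
      case (Suc t)
      obtain s where s: "s \<in> R (cur (alg_moves ?f Q t))" "cur (alg_moves ?f Q (Suc t)) = s"
        "alg (Suc t) \<omega> = alg t \<omega> + d (cur (alg_moves ?f Q t)) s"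
        using step by blast
      have "ad e (Suc (Suc t)) \<omega> = ad e (Suc t) \<omega> + d (X e (cur (alg_moves ?f Q t))) (X e s)" for e
        unfolding ad_def adv_moves_Suc[of _ _ _ "Suc t"] path_cost_snoc last_adv
        by (simp only: Y_def s(2))
      then have "(\<Sum>e\<in>E. ad e (Suc (Suc t)) \<omega>)
          \<le> (\<Sum>e\<in>E. ad e (Suc t) \<omega>) + d (cur (alg_moves ?f Q t)) s"
        using moves[OF cur s(1)] by (simp add: sum.distrib)
      with Suc s(3) show ?case by simp
    qed
  qed
  have alg_mono: "alg t \<omega> \<le> alg (Suc t) \<omega>" for t \<omega>
    by (simp add: alg_def Let_def path_cost_snoc)
  have path_nonneg: "0 \<le> path_cost d s xs" for s xs
    by (induction xs arbitrary: s) auto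

  obtain C where C: "\<And>e t. e \<in> E \<Longrightarrow> (\<integral>\<omega>. alg t \<omega> \<partial>P) \<le> \<rho> * (\<integral>\<omega>. ad e t \<omega> \<partial>P) + C"
    using comp M adv unfolding competitive_def alg_expected_cost_def adv_expected_cost_def
      alg_def ad_def by metis
  \<comment> \<open>A negative \<rho> would reverse the bound on the adversaries' cost when
    multiplied in.\<close>
  define r where "r = max 0 \<rho>"
  have r: "0 \<le> r" "r < N" using \<open>\<rho> < real (card E)\<close> N by (auto simp: r_def N_def)
  \<comment> \<open>Adding the competitive inequalities over \<open>E\<close> gives
    \<open>N * ?a\<close> at most \<open>r * (K + ?a) + N * C\<close>, while \<open>?a\<close> is at
    least \<open>t + 1\<close>. The right side here does not depend on \<open>t\<close>.\<close>
  have bound: "real (Suc t) * (N - r) \<le> r * K + N * C" for t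
  proof -
    let ?a = "\<integral>\<omega>. alg (Suc t) \<omega> \<partial>P"
    have "?a \<le> r * (\<integral>\<omega>. ad e (Suc t) \<omega> \<partial>P) + C" if "e \<in> E" for e
    proof -
      have "0 \<le> (\<integral>\<omega>. ad e (Suc t) \<omega> \<partial>P)"
        by (rule Bochner_Integration.integral_nonneg) (simp add: ad_def path_nonneg)
      then have "\<rho> * (\<integral>\<omega>. ad e (Suc t) \<omega> \<partial>P) \<le> r * (\<integral>\<omega>. ad e (Suc t) \<omega> \<partial>P)"
        by (intro mult_right_mono) (auto simp: r_def)
      with C[OF that, of "Suc t"] show ?thesis by simp
    qed
    then have "(\<Sum>e\<in>E. ?a) \<le> (\<Sum>e\<in>E. r * (\<integral>\<omega>. ad e (Suc t) \<omega> \<partial>P) + C)"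
      by (rule sum_mono)
    then have "N * ?a \<le> r * (\<integral>\<omega>. (\<Sum>e\<in>E. ad e (Suc t) \<omega>) \<partial>P) + N * C"
      by (simp add: sum.distrib sum_distrib_left N_def Bochner_Integration.integral_sum int_ad)
    moreover have "(\<integral>\<omega>. (\<Sum>e\<in>E. ad e (Suc t) \<omega>) \<partial>P) \<le> (\<integral>\<omega>. K + alg (Suc t) \<omega> \<partial>P)"
    proof (rule integral_mono)
      fix \<omega> assume "\<omega> \<in> space P"
      from ad_le[OF this, of t] alg_mono[of t \<omega>]
      show "(\<Sum>e\<in>E. ad e (Suc t) \<omega>) \<le> K + alg (Suc t) \<omega>" by simp
    qed (auto intro!: int_ad int_alg)
    then have "r * (\<integral>\<omega>. (\<Sum>e\<in>E. ad e (Suc t) \<omega>) \<partial>P) \<le> r * (K + ?a)"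
      using r(1) by (intro mult_left_mono) (simp_all add: int_alg prob_space)
    ultimately have "(N - r) * ?a \<le> r * K + N * C"
      by (simp add: algebra_simps)
    moreover have "real (Suc t) \<le> ?a"
      using integral_mono[of P "\<lambda>_. real (Suc t)" "alg (Suc t)", OF _ int_alg alg_ge]
      by (simp add: prob_space)
    then have "real (Suc t) * (N - r) \<le> (N - r) * ?a"
      using r(2) by (simp add: mult.commute mult_left_mono)
    ultimately show ?thesis by linarith
  qed
  obtain t where "(r * K + N * C) / (N - r) < real t"
    using reals_Archimedean2 by blast
  then have "r * K + N * C < real t * (N - r)"
    using r(2) by (simp add: divide_simps)
  with bound[of t] r(2) show False
    by (simp add: algebra_simps)
qed

section \<open>The tree\<close>

text \<open>The exponent involves both lengths because \<open>Metric_space\<close> demands symmetry off the carrier too.\<close>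

fun tree_dist :: "bool list \<Rightarrow> bool list \<Rightarrow> real" where
  "tree_dist (a # u) (b # v) = (if a = b then tree_dist u v else 2 ^ (length u * length v))"
| "tree_dist _ _ = 0"

fun tree_request :: "bool list \<Rightarrow> bool list set" where
  "tree_request [] = {}"
| "tree_request (a # u) =
     insert ((\<not> a) # replicate (length u) False) ((#) a ` tree_request u)"

text \<open>A bottom pair of siblings is addressed by the path to its parent.\<close>

fun tree_server :: "bool list \<Rightarrow> bool list \<Rightarrow> bool list" where
  "tree_server [] z = map Not z"
| "tree_server (b # e) [] = []"
| "tree_server (b # e) (a # u) =
     (if a = b then a # tree_server e u else b # replicate (length u) False)"

section \<open>The ultrametric on leaves\<close>

lemma tree_dist_nonneg: "0 \<le> tree_dist u v"
  by (induction u v rule: tree_dist.induct) auto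

lemma tree_dist_commute: "tree_dist u v = tree_dist v u"
  by (induction u v rule: tree_dist.induct) (auto simp: mult.commute)

lemma tree_dist_ge_1: "length u = length v \<Longrightarrow> u \<noteq> v \<Longrightarrow> 1 \<le> tree_dist u v"
  by (induction u v rule: list_induct2) auto

lemma tree_dist_self [simp]: "tree_dist u u = 0"
  by (induction u) auto

lemma tree_dist_le:
  assumes "length u = n" "length v = n"
  shows "tree_dist u v \<le> 2 ^ ((n - 1) * (n - 1))"
proof -
  have "length u = length v" using assms by simp
  then have "tree_dist u v \<le> 2 ^ ((length u - 1) * (length u - 1))"
  proof (induction u v rule: list_induct2)
    case (Cons a u b v)
    have "(2::real) ^ ((length u - 1) * (length u - 1)) \<le> 2 ^ (length u * length u)"
      by (intro power_increasing mult_le_mono) auto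
    from order_trans[OF Cons.IH this] show ?case using Cons.hyps by simp
  qed simp
  with assms show ?thesis by simp
qed

text \<open>If only \<open>v\<close> lies across the top split, both distances on the right are the
  top one, which exceeds any distance within a subtree. If the top split separates \<open>u\<close>
  from \<open>w\<close>, it also separates \<open>v\<close> from one of them.\<close>

lemma tree_dist_ultra:
  "length u = length v \<Longrightarrow> length v = length w \<Longrightarrow>
    tree_dist u w \<le> max (tree_dist u v) (tree_dist v w)"
proof (induction u v w rule: list_induct3)
  case (Cons a u b v c w)
  have "tree_dist u w \<le> 2 ^ (length u * length u)"
  proof -
    have "tree_dist u w \<le> 2 ^ ((length u - 1) * (length u - 1))"
      using Cons by (intro tree_dist_le) auto
    also have "(2::real) ^ ((length u - 1) * (length u - 1)) \<le> 2 ^ (length u * length u)"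
      by (intro power_increasing mult_le_mono) auto
    finally show ?thesis .
  qed
  with Cons show ?case by auto
qed simp

lemma Metric_space_tree: "Metric_space {z. length z = k} tree_dist"
proof
  fix x y z :: "bool list"
  assume "x \<in> {z. length z = k}" "y \<in> {z. length z = k}" "z \<in> {z. length z = k}"
  then show "tree_dist x z \<le> tree_dist x y + tree_dist y z"
    using tree_dist_ultra[of x y z] tree_dist_nonneg[of x y] tree_dist_nonneg[of y z] by auto
next
  fix x y :: "bool list"
  assume "x \<in> {z. length z = k}" "y \<in> {z. length z = k}"
  then show "tree_dist x y = 0 \<longleftrightarrow> x = y"
    using tree_dist_ge_1[of x y] by fastforce
next
  fix x y :: "bool list"
  show "tree_dist x y = tree_dist y x"
    by (rule tree_dist_commute)
qed (rule tree_dist_nonneg)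

section \<open>Requests and the servers' answers\<close>

lemma length_tree_request: "v \<in> tree_request u \<Longrightarrow> length v = length u"
  by (induction u arbitrary: v) auto

text \<open>Each request thus forces the algorithm off its leaf, at cost at least 1.\<close>

lemma tree_request_irrefl: "u \<notin> tree_request u"
  by (induction u) auto

lemma card_tree_request_le: "finite (tree_request u) \<and> card (tree_request u) \<le> length u"
proof (induction u)
  case (Cons a u)
  then show ?case
    using card_image_le[of "tree_request u" "(#) a"]
    by (auto intro!: order_trans[OF card_insert_le_m1])
qed simp

lemma request_tree_request:
  assumes "length z = k" "1 \<le> k"
  shows "request k {z. length z = k} (tree_request z)"
proof -
  have "tree_request z \<noteq> {}" using assms by (cases z) auto
  then show ?thesis
    using card_tree_request_le[of z] length_tree_request[of _ z] assms
    by (auto simp: request_def Suc_le_eq card_gt_0_iff)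
qed

lemma tree_server_in_request: "length z = Suc (length e) \<Longrightarrow> tree_server e z \<in> tree_request z"
proof (induction e z rule: tree_server.induct)
  case (1 z)
  then show ?case by (cases z) auto
qed auto

text \<open>Splitting at a given letter \<open>a\<close>, rather than at True and False, separates
  the servers on the algorithm's side of the root from the others.\<close>

lemma sum_lists_Suc:
  fixes F :: "bool list \<Rightarrow> 'c :: comm_monoid_add"
  shows "(\<Sum>e | length e = Suc n. F e) = (\<Sum>e | length e = n. F (a # e) + F ((\<not> a) # e))"
proof -
  have "{e. length e = Suc n} = (#) a ` {e. length e = n} \<union> (#) (\<not> a) ` {e. length e = n}"
    by (auto simp: length_Suc_conv image_iff)
  moreover have "finite {e :: bool list. length e = n}"
    using finite_lists_length_eq[of "UNIV :: bool set" n] by simp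
  ultimately have "(\<Sum>e | length e = Suc n. F e)
      = sum F ((#) a ` {e. length e = n}) + sum F ((#) (\<not> a) ` {e. length e = n})"
    by (simp only:) (rule sum.union_disjoint, auto)
  then show ?thesis
    by (simp add: sum.reindex sum.distrib)
qed

lemma card_bool_lists: "card {e :: bool list. length e = n} = 2 ^ n"
  using card_lists_length_eq[of "UNIV :: bool set" n] by simp

text \<open>If the algorithm stays on its side of the root, the servers across the root stand still
  and induction applies. If it crosses, every server moves only within its own half: those on the
  old side retreat to the fixed leaf \<open>?O\<close>, those on the new side leave it.\<close>

lemma sum_tree_server_moves_le:
  assumes "length z = Suc n" "z' \<in> tree_request z"
  shows "(\<Sum>e | length e = n. tree_dist (tree_server e z) (tree_server e z')) \<le> tree_dist z z'"
  using assms
proof (induction n arbitrary: z z')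
  case 0
  then show ?case by (auto simp: length_Suc_conv)
next
  case (Suc n)
  from Suc.prems obtain a u where z: "z = a # u" "length u = Suc n"
    by (cases z) auto
  let ?O = "replicate (Suc n) False"
  from Suc.prems z consider u' where "z' = a # u'" "u' \<in> tree_request u" | "z' = (\<not> a) # ?O"
    by auto
  then show ?case
  proof cases
    case 1
    with Suc.IH[OF z(2) 1(2)] length_tree_request[OF 1(2)] show ?thesis
      by (simp add: z sum_lists_Suc[of _ n a])
  next
    case 2
    \<comment> \<open>Diameter of a half, a subtree of depth \<open>n + 1\<close>. The
      \<open>2 * 2 ^ n\<close> servers together pay at most \<open>2 ^ (n * n + n + 1)\<close>,
      below the crossing cost \<open>2 ^ ((n + 1) * (n + 1))\<close>.\<close>
    let ?D = "2 ^ (n * n) :: real"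
    have "(\<Sum>e | length e = Suc n. tree_dist (tree_server e z) (tree_server e z'))
        = (\<Sum>e | length e = n. tree_dist (tree_server e u) ?O + tree_dist ?O (tree_server e ?O))"
      by (simp add: sum_lists_Suc[of _ n a] z 2 del: replicate_Suc)
    also have "\<dots> \<le> (\<Sum>e :: bool list | length e = n. ?D + ?D)"
    proof (intro sum_mono add_mono)
      fix e :: "bool list" assume "e \<in> {e. length e = n}"
      then have e: "length (tree_server e u) = Suc n" "length (tree_server e ?O) = Suc n"
        using z length_tree_request[OF tree_server_in_request[of u e]]
          length_tree_request[OF tree_server_in_request[of ?O e]] by auto
      show "tree_dist (tree_server e u) ?O \<le> ?D" "tree_dist ?O (tree_server e ?O) \<le> ?D"
        using tree_dist_le[of "tree_server e u" "Suc n" ?O] tree_dist_le[of ?O "Suc n" "tree_server e ?O"] e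
        by (simp_all del: replicate_Suc)
    qed
    also have "\<dots> = 2 ^ (n * n + n + 1)"
      by (simp add: card_bool_lists power_add)
    also have "\<dots> \<le> (2::real) ^ (Suc n * Suc n)"
      by (intro power_increasing) auto
    also have "\<dots> = tree_dist z z'" by (simp add: z 2)
    finally show ?thesis .
  qed
qed

section \<open>The lower bound\<close>

theorem theorem2:
  fixes k :: nat and P :: "'w measure" and A :: "('a, 'w) online_alg"
  assumes "infinite (UNIV :: 'a set)"
    and "k \<ge> 1"
    and "randomized_online_alg k P A"
  shows "competitive_ratio_at_least k P A (2 ^ (k - 1))"
  unfolding competitive_ratio_at_least_def
proof (intro allI impI)
  fix \<rho> :: real assume \<rho>: "\<rho> < 2 ^ (k - 1)"
  \<comment> \<open>The point type is an arbitrary infinite one, so the tree is copied into it along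
    an injection.\<close>
  obtain c :: "nat \<Rightarrow> 'a" where c: "inj c"
    using assms(1) infinite_countable_subset by blast
  define g where "g = c \<circ> (to_nat :: bool list \<Rightarrow> nat)"
  have g: "inj g" using c by (simp add: g_def inj_compose)
  define L where "L = {z :: bool list. length z = k}"
  \<comment> \<open>Composing with \<open>inv g\<close> keeps symmetry and nonnegativity outside the
    carrier as well, as \<open>Metric_space\<close> demands.\<close>
  define d where "d x y = tree_dist (inv g x) (inv g y)" for x y
  define R where "R x = g ` tree_request (inv g x)" for x
  define X where "X e x = g (tree_server e (inv g x))" for e x
  define E where "E = {e :: bool list. length e = k - 1}"
  interpret tree: Metric_space L tree_dist unfolding L_def by (rule Metric_space_tree)
  have d: "d (g u) (g v) = tree_dist u v" for u v
    using g by (simp add: d_def)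
  have finE: "finite E" "E \<noteq> {}"
    using card_bool_lists[of "k - 1"] by (auto simp: E_def card_gt_0_iff intro: card_ge_0_finite Ex_list_of_length)
  show "\<not> competitive k P A \<rho>"
  proof (rule not_competitive_memoryless[where M = "g ` L" and d = d and ?s0.0 = "g (replicate k False)"
        and R = R and X = X and E = E])
    show "Metric_space (g ` L) d"
    proof
      fix x y z assume "x \<in> g ` L" "y \<in> g ` L" "z \<in> g ` L"
      then show "d x z \<le> d x y + d y z"
        using tree.triangle by (auto simp: d)
    next
      fix x y assume "x \<in> g ` L" "y \<in> g ` L"
      then show "d x y = 0 \<longleftrightarrow> x = y"
        by (auto simp: d tree.zero inj_eq[OF g])
    qed (auto simp: d_def tree.commute)
    show "finite (g ` L)"
      using finite_lists_length_eq[of "UNIV :: bool set" k] by (simp add: L_def)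
    show "request k (g ` L) (R z)" if "z \<in> g ` L" for z
    proof -
      obtain u where u: "z = g u" "u \<in> L" using \<open>z \<in> g ` L\<close> by blast
      have "request k L (tree_request u)"
        using u assms(2) by (auto simp: L_def intro: request_tree_request)
      then show ?thesis
        using g by (auto simp: request_def u R_def card_image inj_on_subset[OF g])
    qed
    show "1 \<le> d z z'" if zz': "z \<in> g ` L" "z' \<in> R z" for z z'
    proof -
      obtain u v where "z = g u" "z' = g v" "v \<in> tree_request u"
        using zz' g by (auto simp: R_def)
      then show ?thesis
        using tree_dist_ge_1[of u v] length_tree_request[of v u] tree_request_irrefl[of u]
        by (auto simp: d)
    qed
    show "X e z \<in> R z" if "e \<in> E" "z \<in> g ` L" for e z
      using that g assms(2) by (auto simp: X_def R_def E_def L_def intro!: imageI tree_server_in_request)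
    show "(\<Sum>e\<in>E. d (X e z) (X e z')) \<le> d z z'" if zz': "z \<in> g ` L" "z' \<in> R z" for z z'
    proof -
      obtain u v where "z = g u" "u \<in> L" "z' = g v" "v \<in> tree_request u"
        using zz' g by (auto simp: R_def)
      then show ?thesis
        using g assms(2) sum_tree_server_moves_le[of u "k - 1" v] by (simp add: X_def d E_def L_def)
    qed
    show "\<rho> < real (card E)" using \<rho> by (simp add: E_def card_bool_lists)
  qed (use assms(3) finE in \<open>auto simp: L_def\<close>)
qed

end
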